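(* Let $G$ be a finite abelian group of type $III$, let $m$ be the exponent of $G$ and $k=\frac{m-1}{6}$. Let $A$ be a sum-free subset of $G$ with $\alpha(A)=\mu(G)$. Let $f:G\to\mathbb{Z}/m\mathbb{Z}$ be a surjective homomorphism such that $A\subset f^{-1}p(\{2k+j:0\le j\le 2k+1\})$ and such that: (i) $\alpha(f,i)\ge 1-m(\mu(G)-\alpha(A))$ for all $i\in p(\{2k+j:2\le j\le 2k-1\})$; (ii) $\alpha(f,2k)+\alpha(f,4k)\ge 1-m(\mu(G)-\alpha(A))$; (iii) $\alpha(f,4k+1)+\alpha(f,2k+1)\ge 1-m(\mu(G)-\alpha(A))$; (iv) if $A$ is maximal sum-free then $f^{-1}p(\{2k+j:2\le j\le 2k-1\})\subset A$. Let $S$ be the kernel of $f$ and let $C$ be a subgroup of $G$ such that $G=S\oplus C$. Let $g:C\to\mathbb{Z}/m\mathbb{Z}$ be the isomorphism obtained by restricting $f$ to $C$. Then there exist a subgroup $J$ of $S$ and $b\in S$ such that one of the following holds: 1. $A=f^{-1}p(\{2k+j:1\le j\le 2k\})$. 2. One of the sets $A$ or $-A$ is equal to $$\big((J+b)\oplus g^{-1}p(\{2k\})\big)\cup f^{-1}p(\{2k+j:1\le j\le 2k-1\})\cup\big((J+2b)^c\oplus g^{-1}p(\{4k\})\big).$$ 3. $A$ is the union of the sets $f^{-1}p(\{2k+j:2\le j\le 2k-1\})$, $(J+b)\oplus g^{-1}p(\{2k\})$, $(J+2b)^c\oplus g^{-1}p(\{4k\})$, $(J-b)\oplus g^{-1}p(\{4k+1\})$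 and $(J-2b)^c\oplus g^{-1}p(\{2k+1\})$.
   Context: A subset $A$ of an abelian group is sum-free if $x+y=z$ has no solution with $x,y,z\in A$ ($x=y$ allowed); it is maximal sum-free if it is sum-free and not a proper subset of any sum-free subset. The density of $A\subset G$ is $\alpha(A)=|A|/|G|$, and $\mu(G)$ is the density of a largest sum-free subset of $G$. A finite abelian group $G$ is of type $III$ if all divisors of $|G|$ are congruent to $1$ modulo $3$; then every divisor $d$ of the exponent $m$ satisfies $d\equiv 1\pmod 6$, and $\mu(G)=\frac13-\frac1{3m}=\frac{2k}{m}$. The map $p:\mathbb{Z}\to\mathbb{Z}/m\mathbb{Z}$ is the natural projection. For a surjective homomorphism $f:G\to\mathbb{Z}/m\mathbb{Z}$ and $i\in\mathbb{Z}/m\mathbb{Z}$, $\alpha(f,i)=\frac{m}{|G|}|A\cap f^{-1}\{i\}|$; integers $2k$, $4k$, etc. as arguments stand for their images in $\mathbb{Z}/m\mathbb{Z}$. For $D\subset S$, $D^c$ denotes $S\setminus D$. For $D\subset S$ and $T\subset C$, $D\oplus T=\{s+c:s\in D,c\in T\}$. Also $-A=\{-a:a\in A\}$. *)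

theory Defs
  imports "HOL-Algebra.Algebra" Complex_Main
begin

text \<open>
  Abelian groups are rendered in the multiplicative notation of HOL-Algebra:
  \<open>x \<otimes> y\<close> is \<open>x + y\<close>, \<open>set_inv A\<close> is \<open>-A\<close>, \<open>b [^] 2\<close> is \<open>2b\<close>, \<open>J #> b\<close> is \<open>J + b\<close>,
  and \<open>D <#> T\<close> is \<open>{s + c | s \<in> D, c \<in> T}\<close>.
\<close>

definition sum_free :: "('a, 'b) monoid_scheme \<Rightarrow> 'a set \<Rightarrow> bool" where
  "sum_free G A \<longleftrightarrow> A \<subseteq> carrier G \<and> (\<forall>x\<in>A. \<forall>y\<in>A. \<forall>z\<in>A. x \<otimes>\<^bsub>G\<^esub> y \<noteq> z)"

definition maximal_sum_free :: "('a, 'b) monoid_scheme \<Rightarrow> 'a set \<Rightarrow> bool" where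
  "maximal_sum_free G A \<longleftrightarrow> sum_free G A \<and> \<not> (\<exists>B. sum_free G B \<and> A \<subset> B)"

definition density :: "('a, 'b) monoid_scheme \<Rightarrow> 'a set \<Rightarrow> real" where
  "density G A = real (card A) / real (order G)"

definition max_density :: "('a, 'b) monoid_scheme \<Rightarrow> real" where
  "max_density G = Max (density G ` {B. sum_free G B})"

definition group_exponent :: "('a, 'b) monoid_scheme \<Rightarrow> nat" where
  "group_exponent G = (LEAST n. 0 < n \<and> (\<forall>x\<in>carrier G. x [^]\<^bsub>G\<^esub> n = \<one>\<^bsub>G\<^esub>))"

definition type_III :: "('a, 'b) monoid_scheme \<Rightarrow> bool" where
  "type_III G \<longleftrightarrow> (\<forall>d::nat. d dvd order G \<longrightarrow> d mod 3 = 1)"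

text \<open>The projection of the integers onto \<open>integer_mod_group m\<close>, whose carrier for \<open>m > 0\<close>
  consists of the representatives \<open>0, \<dots>, m - 1\<close>.\<close>
definition proj_mod :: "nat \<Rightarrow> int \<Rightarrow> int" where
  "proj_mod m x = x mod int m"

text \<open>Here \<open>m\<close> is the exponent of \<open>G\<close>, and the index is an element of \<open>integer_mod_group m\<close>.\<close>
definition fibre_density ::
    "('a, 'b) monoid_scheme \<Rightarrow> 'a set \<Rightarrow> ('a \<Rightarrow> int) \<Rightarrow> int \<Rightarrow> real" where
  "fibre_density G A f i =
     real (group_exponent G) / real (order G) * real (card (A \<inter> (f -` {i} \<inter> carrier G)))"

definition internal_direct_sum ::
    "('a, 'b) monoid_scheme \<Rightarrow> 'a set \<Rightarrow> 'a set \<Rightarrow> bool" where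
  "internal_direct_sum G S C \<longleftrightarrow>
     subgroup S G \<and> subgroup C G \<and> S \<inter> C = {\<one>\<^bsub>G\<^esub>} \<and> S <#>\<^bsub>G\<^esub> C = carrier G"

end

theory Submission
  imports Defs
begin

text \<open>
  Let \<open>A\<^sub>i \<subseteq> S\<close> be the part of \<open>A\<close> above the residue \<open>i\<close>, moved into the kernel \<open>S\<close> by the element
  of \<open>C\<close> above \<open>i\<close> (called \<open>slice A i\<close> below). The elements of \<open>C\<close> add up like the residues, so
  sum-freeness says, additively, that \<open>A\<^sub>i + A\<^sub>j\<close> is disjoint from \<open>A\<^sub>l\<close> whenever \<open>i + j = l\<close> modulo
  \<open>m = 6k + 1\<close>. Since \<open>A\<close> has the maximal density, the error terms in the density hypotheses
  vanish: the slices from \<open>2k + 2\<close> to \<open>4k - 1\<close> are all of \<open>S\<close>, and the pairs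
  \<open>(A\<^bsub>2k\<^esub>, A\<^bsub>4k\<^esub>)\<close> and \<open>(A\<^bsub>4k+1\<^esub>, A\<^bsub>2k+1\<^esub>)\<close> each have at least \<open>|S|\<close> elements in total.
  The slices outside the range from \<open>2k\<close> to \<open>4k + 1\<close> are empty.

  In both pairs the second index is twice the first, modulo \<open>m\<close>. Hence the sumset of the first
  slice with itself avoids the second one. A nonempty finite set \<open>D\<close> satisfies \<open>|D + D| \<ge> |D|\<close>, with
  equality only for cosets of subgroups; by counting, the pair is either \<open>(\<emptyset>, S)\<close> or
  \<open>(J + b, S - (J + 2b))\<close> (\<open>dense_pair_cosets\<close>). If both pairs are of the first kind, \<open>A\<close> is the
  preimage of an interval; if exactly one is, \<open>A\<close> or \<open>-A\<close> is the one-coset example, because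
  negation exchanges the two pairs.

  If the pairs are given by cosets \<open>J + b\<close> and \<open>K + c\<close>, the relations
  \<open>2k + (2k + 1) = 4k + 1\<close> and \<open>(4k + 1) + 4k = 2k\<close> link them: the first forces \<open>J \<subseteq> K\<close> and
  \<open>b + c \<in> K\<close>, the second forces \<open>K \<subseteq> J\<close> (\<open>coset_avoidance_imp_subset\<close>). So \<open>K = J\<close> and
  \<open>K + c = J - b\<close>, which is the two-coset example.
\<close>

section \<open>Small doubling and cosets\<close>

lemma (in group) mem_r_coset_iff:
  assumes "subgroup J G" "x \<in> carrier G" "b \<in> carrier G"
  shows "x \<in> J #> b \<longleftrightarrow> x \<otimes> inv b \<in> J"
  using subgroup.rcos_module[OF assms(1) is_group assms(3,2)] .

text \<open>Every translate of \<open>D\<close> by one of its own elements lies in \<open>D <#> D\<close> and has as many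
  elements as \<open>D\<close>, so all these translates are equal to \<open>D <#> D\<close>. Quotients of elements of \<open>D\<close>
  therefore stabilise \<open>D\<close>, and \<open>D\<close> is a coset of its stabiliser.\<close>
lemma (in comm_group) small_doubling_imp_coset:
  assumes "finite D" "D \<subseteq> carrier G" "b \<in> D" "card (D <#> D) \<le> card D"
  obtains J where "subgroup J G" "D = J #> b" "D <#> D = J #> (b [^] (2::nat))"
proof -
  define J where "J = {h \<in> carrier G. D #> h = D}"
  have b: "b \<in> carrier G" using assms by blast
  have J: "subgroup J G"
  proof (rule subgroupI)
    show "J \<subseteq> carrier G" by (auto simp: J_def)
    have "\<one> \<in> J" using assms(2) by (simp add: J_def)
    then show "J \<noteq> {}" by blast
    show "inv h \<in> J" if "h \<in> J" for h
    proof -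
      have h: "h \<in> carrier G" "D #> h = D" using that by (auto simp: J_def)
      have "D #> inv h = (D #> h) #> inv h" using h by simp
      also have "\<dots> = D" using h(1) assms(2) by (simp add: coset_mult_assoc)
      finally show ?thesis using h(1) by (simp add: J_def)
    qed
    show "h \<otimes> h' \<in> J" if "h \<in> J" "h' \<in> J" for h h'
      using that assms(2) by (simp add: J_def flip: coset_mult_assoc)
  qed
  have fin: "finite (D <#> D)" using assms(1) by (simp add: set_mult_def)
  have translate: "D #> x = D <#> D" if x: "x \<in> D" for x
  proof (rule card_subset_eq[OF fin])
    have xc: "x \<in> carrier G" using x assms(2) by blast
    show sub: "D #> x \<subseteq> D <#> D" using x by (auto simp: r_coset_def set_mult_def)
    have "D #> x = (\<lambda>y. y \<otimes> x) ` D" by (auto simp: r_coset_def)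
    then have "card (D #> x) = card D"
      using inj_on_g[OF assms(2) xc] by (simp add: card_image)
    then show "card (D #> x) = card (D <#> D)"
      using assms(4) card_mono[OF fin sub] by simp
  qed
  have DJ: "D = J #> b"
  proof (intro equalityI subsetI)
    fix x assume x: "x \<in> D"
    then have xc: "x \<in> carrier G" using assms(2) by blast
    have "D #> (x \<otimes> inv b) = (D #> b) #> inv b"
      using translate[OF x] translate[OF assms(3)] xc b assms(2) by (metis coset_mult_assoc inv_closed)
    then have "x \<otimes> inv b \<in> J" using assms(2) b xc by (simp add: J_def coset_mult_assoc)
    then show "x \<in> J #> b" using mem_r_coset_iff[OF J xc b] by blast
  next
    fix x assume "x \<in> J #> b"
    then obtain j where j: "j \<in> J" "x = b \<otimes> j"
      using b m_comm by (force simp: r_coset_def J_def)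
    then have "x \<in> D #> j" using assms(3) by (auto simp: r_coset_def)
    then show "x \<in> D" using j by (simp add: J_def)
  qed
  have "D <#> D = (J #> b) #> b" using translate[OF assms(3)] DJ by simp
  also have "\<dots> = J #> (b [^] (2::nat))"
    using b subgroup.subset[OF J] by (simp add: coset_mult_assoc numeral_2_eq_2)
  finally show ?thesis by (rule that[OF J DJ])
qed

text \<open>The set \<open>D <#> D\<close> avoids \<open>E\<close> and is at least as large as \<open>D\<close> when \<open>D\<close> is nonempty, so the
  cardinalities leave no slack: \<open>D\<close> has minimal doubling and \<open>E\<close> is the complement of
  \<open>D <#> D\<close>.\<close>
lemma (in comm_group) dense_pair_cosets:
  assumes S: "subgroup S G" "finite S" and DE: "D \<subseteq> S" "E \<subseteq> S"
    and avoid: "\<And>x y. \<lbrakk>x \<in> D; y \<in> D\<rbrakk> \<Longrightarrow> x \<otimes> y \<notin> E"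
    and large: "card S \<le> card D + card E"
  shows "(D = {} \<and> E = S) \<or>
    (\<exists>J b. subgroup J G \<and> J \<subseteq> S \<and> b \<in> S \<and> D = J #> b \<and> E = S - (J #> (b [^] (2::nat))))"
proof (cases "D = {}")
  case True
  then have "card S \<le> card E" using large by simp
  then have "E = S" using card_seteq[OF S(2) DE(2)] by blast
  then show ?thesis using True by blast
next
  case False
  then obtain b where b: "b \<in> D" by blast
  have carr: "S \<subseteq> carrier G" using subgroup.subset[OF S(1)] .
  have bS: "b \<in> S" and bc: "b \<in> carrier G" using b DE carr by auto
  have fin: "finite D" "finite E" using DE S(2) finite_subset by auto
  have DD: "D <#> D \<subseteq> S"
    using subgroup.m_closed[OF S(1) subsetD[OF DE(1)] subsetD[OF DE(1)]]
    by (auto simp: set_mult_def)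
  have fDD: "finite (D <#> D)" using DD S(2) finite_subset by auto
  have disj: "(D <#> D) \<inter> E = {}" using avoid by (auto simp: set_mult_def)
  have "card (D <#> D) + card E = card ((D <#> D) \<union> E)"
    using card_Un_disjoint[OF fDD fin(2) disj] by simp
  also have "\<dots> \<le> card S" using DD DE S(2) by (intro card_mono) auto
  finally have upper: "card (D <#> D) + card E \<le> card S" .
  then have doubling: "card (D <#> D) \<le> card D" using large by simp
  obtain J where J: "subgroup J G" "D = J #> b" "D <#> D = J #> (b [^] (2::nat))"
    using small_doubling_imp_coset[OF fin(1) _ b doubling] DE carr by blast
  have "J \<subseteq> S"
  proof
    fix j assume j: "j \<in> J"
    then have jc: "j \<in> carrier G" using subgroup.mem_carrier[OF J(1)] by blast
    have "j \<otimes> b \<in> D" unfolding J(2) using j by (auto simp: r_coset_def)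
    then have "j \<otimes> b \<in> S" using DE(1) by blast
    then have "j \<otimes> b \<otimes> inv b \<in> S"
      using bS subgroup.m_closed[OF S(1)] subgroup.m_inv_closed[OF S(1)] by blast
    then show "j \<in> S" using jc bc by (simp add: m_assoc)
  qed
  moreover have "E = S - (J #> (b [^] (2::nat)))"
  proof -
    have "card D \<le> card (D <#> D)"
    proof -
      have "D = (\<lambda>x. x \<otimes> inv b) ` (D #> b)"
        using DE carr bc by (force simp: r_coset_def image_UN m_assoc)
      moreover have "D #> b \<subseteq> D <#> D" using b by (auto simp: r_coset_def set_mult_def)
      ultimately have "D \<subseteq> (\<lambda>x. x \<otimes> inv b) ` (D <#> D)" by (metis image_mono)
      then show ?thesis using fDD by (meson surj_card_le)
    qed
    then have "card S \<le> card (D <#> D) + card E" using large by simp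
    then have "card S \<le> card ((D <#> D) \<union> E)"
      using card_Un_disjoint[OF fDD fin(2) disj] by simp
    moreover have "(D <#> D) \<union> E \<subseteq> S" using DD DE by auto
    ultimately have "(D <#> D) \<union> E = S" using S(2) by (intro card_seteq)
    then show ?thesis using disj unfolding J(3) by blast
  qed
  ultimately show ?thesis using J(1,2) bS by (intro disjI2 exI[of _ J] exI[of _ b]) simp
qed

text \<open>Any \<open>x\<close> in \<open>J #> b\<close> carries \<open>c \<otimes> inv x\<close> to \<open>c\<close>, an element of \<open>K #> c\<close>. The hypothesis thus
  forces \<open>c \<otimes> inv x\<close> into \<open>K #> c [^] 2\<close>, that is, \<open>x \<otimes> c\<close> into \<open>K\<close>. Taking \<open>x = j \<otimes> b\<close>, first
  for \<open>j = \<one>\<close> and then for every \<open>j\<close> in \<open>J\<close>, gives the two conclusions.\<close>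
lemma (in comm_group) coset_avoidance_imp_subset:
  assumes S: "subgroup S G" and J: "subgroup J G" "J \<subseteq> S" and K: "subgroup K G"
    and bc: "b \<in> S" "c \<in> S"
    and avoid: "\<And>x y. \<lbrakk>x \<in> J #> b; y \<in> S - (K #> (c [^] (2::nat)))\<rbrakk> \<Longrightarrow> x \<otimes> y \<notin> K #> c"
  shows "J \<subseteq> K" "b \<otimes> c \<in> K"
proof -
  have carr: "S \<subseteq> carrier G" using subgroup.subset[OF S] .
  have b: "b \<in> carrier G" and c: "c \<in> carrier G" using bc carr by auto
  have key: "j \<otimes> (b \<otimes> c) \<in> K" if "j \<in> J" for j
  proof -
    have j: "j \<in> S" "j \<in> carrier G" using that J carr by auto
    let ?x = "j \<otimes> b" and ?y = "c \<otimes> inv (j \<otimes> b)"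
    have x: "?x \<in> J #> b" using that by (auto simp: r_coset_def)
    have yS: "?y \<in> S" using j bc subgroup.m_closed[OF S] subgroup.m_inv_closed[OF S] by simp
    have "?x \<otimes> ?y = c" using j b c by (metis inv_closed m_closed m_lcomm r_inv r_one)
    moreover have "c \<in> K #> c" using rcos_self[OF c K] .
    ultimately have "?y \<in> K #> (c [^] (2::nat))" using avoid[OF x, of ?y] yS by auto
    then obtain h where h: "h \<in> K" "?y = h \<otimes> (c \<otimes> c)"
      using c by (auto simp: r_coset_def numeral_2_eq_2)
    have hc: "h \<in> carrier G" using h(1) subgroup.mem_carrier[OF K] by blast
    have xc: "?x \<in> carrier G" using j b by simp
    have "c \<otimes> inv ?x = c \<otimes> (h \<otimes> c)" using h(2) hc c by (simp add: m_lcomm)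
    then have inv_x: "inv ?x = h \<otimes> c" using c hc xc by (simp only: l_cancel inv_closed m_closed)
    have "?x \<otimes> c \<otimes> h = ?x \<otimes> (h \<otimes> c)" using xc c hc by (simp only: m_assoc m_comm[OF c hc])
    also have "\<dots> = \<one>" using inv_x r_inv[OF xc] by simp
    finally have "inv h = ?x \<otimes> c" using inv_equality xc c hc by blast
    then have "?x \<otimes> c \<in> K" using subgroup.m_inv_closed[OF K h(1)] by simp
    then show ?thesis using j b c by (simp add: m_assoc)
  qed
  show bcK: "b \<otimes> c \<in> K" using key[OF subgroup.one_closed[OF J(1)]] b c by simp
  show "J \<subseteq> K"
  proof
    fix j assume j: "j \<in> J"
    have "j \<otimes> (b \<otimes> c) \<otimes> inv (b \<otimes> c) \<in> K"
      using key[OF j] bcK subgroup.m_closed[OF K] subgroup.m_inv_closed[OF K] by blast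
    moreover have "j \<in> carrier G" using j subgroup.mem_carrier[OF J(1)] by blast
    ultimately show "j \<in> K" using b c by (simp add: m_assoc del: inv_mult inv_mult_group)
  qed
qed

lemma (in comm_group) r_coset_cong_inv:
  assumes J: "subgroup J G" and bc: "b \<in> carrier G" "c \<in> carrier G" "b \<otimes> c \<in> J"
  shows "J #> c = J #> inv b" "J #> (c [^] (2::nat)) = J #> inv (b [^] (2::nat))"
proof -
  have cong: "J #> y = J #> inv x" if "x \<in> carrier G" "y \<in> carrier G" "x \<otimes> y \<in> J" for x y
  proof -
    have "y \<otimes> inv (inv x) \<in> J" using that m_comm[of x y] by simp
    then have "y \<in> J #> inv x" using mem_r_coset_iff[OF J] that by blast
    from repr_independence[OF this _ J] show ?thesis using that by simp
  qed
  show "J #> c = J #> inv b" using cong bc by blast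
  have "(b \<otimes> c) \<otimes> (b \<otimes> c) \<in> J" using subgroup.m_closed[OF J bc(3) bc(3)] .
  moreover have "(b \<otimes> c) \<otimes> (b \<otimes> c) = b [^] (2::nat) \<otimes> c [^] (2::nat)"
    using bc(1,2) by (simp add: numeral_2_eq_2 m_ac)
  ultimately show "J #> (c [^] (2::nat)) = J #> inv (b [^] (2::nat))"
    using bc(1,2) by (intro cong) simp_all
qed

lemma (in comm_group) inv_mem_r_coset_iff:
  assumes J: "subgroup J G" and c: "c \<in> carrier G" and x: "x \<in> carrier G"
  shows "inv x \<in> J #> c \<longleftrightarrow> x \<in> J #> inv c"
proof -
  have eq: "inv (inv x \<otimes> inv c) = x \<otimes> c" using c x by (simp add: inv_mult)
  have eq': "inv (x \<otimes> c) = inv x \<otimes> inv c" using c x by (simp add: inv_mult)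
  have "inv x \<otimes> inv c \<in> J \<longleftrightarrow> x \<otimes> c \<in> J"
    using subgroup.m_inv_closed[OF J, of "inv x \<otimes> inv c"] subgroup.m_inv_closed[OF J, of "x \<otimes> c"]
    unfolding eq eq' by blast
  then show ?thesis using mem_r_coset_iff[OF J] c x by simp
qed

section \<open>Slices over a complement of the kernel\<close>

locale split_epi = comm_group G for G :: "('a, 'b) monoid_scheme" (structure) +
  fixes S C :: "'a set" and f :: "'a \<Rightarrow> int" and m :: nat
  assumes fin: "finite (carrier G)"
    and epi: "f \<in> epi G (integer_mod_group m)"
    and ker: "S = kernel G (integer_mod_group m) f"
    and dsum: "internal_direct_sum G S C"
begin

text \<open>The inverse of the isomorphism that \<open>f\<close> induces from \<open>C\<close> to the residues modulo \<open>m\<close>,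
  precomposed with the projection from the integers.\<close>
definition lift :: "int \<Rightarrow> 'a" where
  "lift i = inv_into C f (i mod int m)"

text \<open>The index ranges over all integers, not only over the carrier of \<open>integer_mod_group m\<close>, so
  that indices can be added and negated freely; only its residue class matters.\<close>
definition slice :: "'a set \<Rightarrow> int \<Rightarrow> 'a set" where
  "slice A i = {s \<in> S. s \<otimes> lift i \<in> A}"

definition band :: "int \<Rightarrow> int \<Rightarrow> 'a set" where
  "band l u = f -` {l..u} \<inter> carrier G"

text \<open>As \<open>f\<close> is injective on \<open>C\<close>, the second factor is \<open>{lift j}\<close>: this is \<open>D\<close> moved to the fibre
  over \<open>j\<close>.\<close>
definition layer :: "'a set \<Rightarrow> int \<Rightarrow> 'a set" where
  "layer D j = D <#> (f -` {j mod int m} \<inter> C)"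

lemma m_pos: "0 < m"
proof (rule ccontr)
  assume "\<not> 0 < m"
  then have "f ` carrier G = (UNIV :: int set)"
    using epi by (simp add: epi_def carrier_integer_mod_group)
  moreover have "finite (f ` carrier G)" using fin by simp
  ultimately show False by (simp add: infinite_UNIV_int)
qed

lemma f_image: "f ` carrier G = {0..<int m}"
  using epi m_pos by (simp add: epi_def carrier_integer_mod_group)

lemma f_mod: "x \<in> carrier G \<Longrightarrow> f x mod int m = f x"
  using f_image by (metis atLeastLessThan_iff imageI mod_pos_pos_trivial)

lemma f_mult: "\<lbrakk>x \<in> carrier G; y \<in> carrier G\<rbrakk> \<Longrightarrow> f (x \<otimes> y) = (f x + f y) mod int m"
  using epi by (simp add: epi_def hom_def)

lemma f_inv: "x \<in> carrier G \<Longrightarrow> f (inv x) = (- f x) mod int m"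
proof -
  assume x: "x \<in> carrier G"
  have "group_hom G (integer_mod_group m) f"
    using epi by (simp add: group_hom_def group_hom_axioms_def epi_def)
  then show ?thesis
    using x epi by (simp add: group_hom.hom_inv epi_def hom_def Pi_def)
qed

lemma S_subgroup: "subgroup S G" and C_subgroup: "subgroup C G" and SC_one: "S \<inter> C = {\<one>}"
  and SC_all: "S <#> C = carrier G"
  using dsum by (auto simp: internal_direct_sum_def)

lemma S_carrier: "s \<in> S \<Longrightarrow> s \<in> carrier G" and C_carrier: "c \<in> C \<Longrightarrow> c \<in> carrier G"
  using subgroup.mem_carrier[OF S_subgroup] subgroup.mem_carrier[OF C_subgroup] by auto

lemma S_finite: "finite S"
  using fin S_carrier by (meson finite_subset subsetI)

lemma S_iff: "s \<in> S \<longleftrightarrow> s \<in> carrier G \<and> f s = 0"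
  by (simp add: ker kernel_def)

lemma f_inj_on_C: "inj_on f C"
proof (rule inj_onI)
  fix c d assume cd: "c \<in> C" "d \<in> C" "f c = f d"
  have carr: "c \<in> carrier G" "d \<in> carrier G" using cd C_carrier by auto
  have "f (c \<otimes> inv d) = 0"
    using carr cd(3) by (simp add: f_mult f_inv mod_simps)
  then have "c \<otimes> inv d \<in> S \<inter> C"
    using carr cd C_subgroup by (simp add: S_iff subgroup.m_closed subgroup.m_inv_closed)
  then have "c \<otimes> inv d = \<one>" using SC_one by simp
  then show "c = d" using carr by (metis inv_closed inv_equality inv_inv)
qed

lemma f_image_C: "f ` C = {0..<int m}"
proof
  show "f ` C \<subseteq> {0..<int m}" using f_image C_carrier by blast
  show "{0..<int m} \<subseteq> f ` C"
  proof
    fix i assume "i \<in> {0..<int m}"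
    then obtain x where x: "x \<in> carrier G" "f x = i" using f_image by (metis imageE)
    from x(1) have "x \<in> S <#> C" by (simp add: SC_all)
    then obtain s c where sc: "s \<in> S" "c \<in> C" "x = s \<otimes> c"
      by (auto simp: set_mult_def)
    then have "f x = f c" using S_iff C_carrier by (simp add: f_mult f_mod)
    then show "i \<in> f ` C" using x sc by blast
  qed
qed

lemma lift_in_C: "lift i \<in> C" and f_lift: "f (lift i) = i mod int m"
proof -
  have "i mod int m \<in> f ` C" using f_image_C m_pos by simp
  then show "lift i \<in> C" "f (lift i) = i mod int m"
    unfolding lift_def by (auto intro: inv_into_into f_inv_into_f)
qed

lemma lift_carrier [simp]: "lift i \<in> carrier G"
  using lift_in_C C_carrier by blast

lemma lift_eqI: "\<lbrakk>c \<in> C; f c = i mod int m\<rbrakk> \<Longrightarrow> c = lift i"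
  using f_inj_on_C lift_in_C f_lift by (metis inj_onD)

lemma lift_add: "lift i \<otimes> lift j = lift (i + j)"
  by (rule lift_eqI)
    (simp_all add: lift_in_C subgroup.m_closed[OF C_subgroup] f_mult f_lift mod_simps)

lemma lift_minus: "inv (lift i) = lift (- i)"
  by (rule lift_eqI)
    (simp_all add: lift_in_C subgroup.m_inv_closed[OF C_subgroup] f_inv f_lift mod_simps)

lemma lift_cong: "i mod int m = j mod int m \<Longrightarrow> lift i = lift j"
  by (simp add: lift_def)

lemma slice_cong: "i mod int m = j mod int m \<Longrightarrow> slice A i = slice A j"
  unfolding slice_def by (simp only: lift_cong[of i j])

lemma slice_subset: "slice A i \<subseteq> S"
  by (auto simp: slice_def)

lemma f_translate: "s \<in> S \<Longrightarrow> f (s \<otimes> lift i) = i mod int m"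
  using S_iff by (simp add: f_mult f_lift)

lemma translate_carrier: "s \<in> S \<Longrightarrow> s \<otimes> lift i \<in> carrier G"
  using S_carrier by simp

lemma decompose:
  assumes "x \<in> carrier G"
  obtains s i where "s \<in> S" "0 \<le> i" "i < int m" "f x = i" "x = s \<otimes> lift i"
proof -
  from assms have "x \<in> S <#> C" by (simp add: SC_all)
  then obtain s c where sc: "s \<in> S" "c \<in> C" "x = s \<otimes> c"
    by (auto simp: set_mult_def)
  then have "f x = f c" using S_iff C_carrier by (simp add: f_mult f_mod)
  then have "c = lift (f x)" using lift_eqI sc C_carrier f_mod by simp
  moreover have "f x \<in> {0..<int m}" using f_image assms by blast
  ultimately show ?thesis using that[of s "f x"] sc by auto
qed

lemma translate_mem_layer_iff:
  assumes "D \<subseteq> S" "s \<in> S"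
  shows "s \<otimes> lift i \<in> layer D j \<longleftrightarrow> i mod int m = j mod int m \<and> s \<in> D"
proof -
  have fibre: "f -` {j mod int m} \<inter> C = {lift j}"
    using lift_eqI lift_in_C f_lift by auto
  show ?thesis
  proof
    assume "s \<otimes> lift i \<in> layer D j"
    then obtain x where x: "x \<in> D" "s \<otimes> lift i = x \<otimes> lift j"
      unfolding layer_def fibre by (auto simp: set_mult_def)
    have ij: "i mod int m = j mod int m"
      using f_translate x assms by (metis subsetD)
    then have "s \<otimes> lift i = x \<otimes> lift i" using x lift_cong by metis
    then have "s = x" using assms x S_carrier by (meson lift_carrier r_cancel subsetD)
    then show "i mod int m = j mod int m \<and> s \<in> D" using ij x by blast
  next
    assume "i mod int m = j mod int m \<and> s \<in> D"
    then have "lift i = lift j" "s \<in> D" using lift_cong by blast+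
    then show "s \<otimes> lift i \<in> layer D j"
      unfolding layer_def fibre by (auto simp: set_mult_def)
  qed
qed

lemma set_eq_if_slices_eq:
  assumes "A \<subseteq> carrier G" "B \<subseteq> carrier G"
    and "\<And>i. \<lbrakk>0 \<le> i; i < int m\<rbrakk> \<Longrightarrow> slice A i = slice B i"
  shows "A = B"
proof -
  have "x \<in> A \<longleftrightarrow> x \<in> B" if "x \<in> carrier G" for x
  proof -
    obtain s i where x: "s \<in> S" "0 \<le> i" "i < int m" "x = s \<otimes> lift i"
      using decompose[OF \<open>x \<in> carrier G\<close>] by blast
    have "s \<in> slice A i \<longleftrightarrow> s \<in> slice B i" using assms(3) x by blast
    then show ?thesis using x by (simp add: slice_def)
  qed
  then show ?thesis using assms by blast
qed

lemma slice_Un: "slice (A \<union> B) i = slice A i \<union> slice B i"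
  by (auto simp: slice_def)

lemma slice_band:
  assumes "0 \<le> i" "i < int m"
  shows "slice (band l u) i = (if l \<le> i \<and> i \<le> u then S else {})"
  using f_translate translate_carrier assms by (auto simp: slice_def band_def)

lemma slice_layer:
  assumes "D \<subseteq> S" "0 \<le> j" "j < int m" "0 \<le> i" "i < int m"
  shows "slice (layer D j) i = (if i = j then D else {})"
  using translate_mem_layer_iff[OF assms(1)] assms by (auto simp: slice_def)

lemma band_carrier: "band l u \<subseteq> carrier G"
  by (auto simp: band_def)

lemma layer_carrier: "D \<subseteq> S \<Longrightarrow> layer D j \<subseteq> carrier G"
  using S_carrier C_carrier by (auto simp: layer_def set_mult_def)

lemma slice_set_inv:
  assumes "A \<subseteq> carrier G"
  shows "slice (set_inv A) i = {s \<in> S. inv s \<in> slice A (- i)}"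
proof -
  have "x \<in> set_inv A \<longleftrightarrow> inv x \<in> A" if "x \<in> carrier G" for x
    using assms that by (force simp: SET_INV_def)
  moreover have "inv (s \<otimes> lift i) = inv s \<otimes> lift (- i)" if "s \<in> S" for s
    using that S_carrier by (simp add: inv_mult lift_minus)
  ultimately show ?thesis
    using translate_carrier subgroup.m_inv_closed[OF S_subgroup] by (auto simp: slice_def)
qed

text \<open>The elements \<open>lift i\<close> multiply like the integers \<open>i\<close> add, so sum-freeness of \<open>A\<close> passes to its
  slices.\<close>
lemma sum_free_slices:
  assumes "sum_free G A" "s \<in> slice A i" "t \<in> slice A j"
  shows "s \<otimes> t \<notin> slice A (i + j)"
proof
  assume "s \<otimes> t \<in> slice A (i + j)"
  then have st: "s \<otimes> t \<otimes> lift (i + j) \<in> A" by (simp add: slice_def)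
  have "(s \<otimes> lift i) \<otimes> (t \<otimes> lift j) = s \<otimes> t \<otimes> lift (i + j)"
    using assms(2,3) S_carrier by (simp add: slice_def m_ac flip: lift_add)
  then show False using assms st by (auto simp: slice_def sum_free_def)
qed

lemma order_eq: "order G = m * card S"
proof -
  have "bij_betw (\<lambda>(s, i). s \<otimes> lift i) (S \<times> {0..<int m}) (carrier G)"
    unfolding bij_betw_def
  proof
    show "inj_on (\<lambda>(s, i). s \<otimes> lift i) (S \<times> {0..<int m})"
    proof (rule inj_onI, clarsimp)
      fix s i t j
      assume *: "s \<in> S" "t \<in> S" "s \<otimes> lift i = t \<otimes> lift j" "0 \<le> i" "i < int m" "0 \<le> j" "j < int m"
      then have "i mod int m = j mod int m" using f_translate by metis
      then have "i = j" using * by simp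
      then show "s = t \<and> i = j" using * S_carrier by (meson lift_carrier r_cancel)
    qed
    show "(\<lambda>(s, i). s \<otimes> lift i) ` (S \<times> {0..<int m}) = carrier G"
    proof (intro equalityI subsetI)
      fix x assume x: "x \<in> carrier G"
      then obtain s i where "s \<in> S" "0 \<le> i" "i < int m" "x = s \<otimes> lift i"
        using decompose by blast
      then show "x \<in> (\<lambda>(s, i). s \<otimes> lift i) ` (S \<times> {0..<int m})" by force
    qed (use translate_carrier in auto)
  qed
  from bij_betw_same_card[OF this] show ?thesis by (simp add: order_def card_cartesian_product mult.commute)
qed

lemma fibre_density_eq_slice:
  assumes "m = group_exponent G" "A \<subseteq> carrier G"
  shows "fibre_density G A f (i mod int m) = real (card (slice A i)) / real (card S)"
proof -
  have "A \<inter> (f -` {i mod int m} \<inter> carrier G) = (\<lambda>s. s \<otimes> lift i) ` slice A i"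
  proof (intro equalityI subsetI)
    fix x assume x: "x \<in> A \<inter> (f -` {i mod int m} \<inter> carrier G)"
    then obtain s j where s: "s \<in> S" "0 \<le> j" "j < int m" "f x = j" "x = s \<otimes> lift j"
      using decompose by blast
    have "lift j = lift i" using x s by (intro lift_cong) simp
    then show "x \<in> (\<lambda>s. s \<otimes> lift i) ` slice A i" using x s by (auto simp: slice_def)
  qed (use f_translate translate_carrier in \<open>auto simp: slice_def\<close>)
  moreover have "inj_on (\<lambda>s. s \<otimes> lift i) (slice A i)"
    using slice_subset S_carrier by (intro inj_on_g) auto
  ultimately have "card (A \<inter> (f -` {i mod int m} \<inter> carrier G)) = card (slice A i)"
    by (simp add: card_image)
  then show ?thesis using assms(1) m_pos by (simp add: fibre_density_def order_eq)
qed

lemma card_S_pos: "0 < card S"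
  using S_finite subgroup.one_closed[OF S_subgroup] card_gt_0_iff by blast

text \<open>By \<open>order_eq\<close>, the divisors of \<open>m\<close> divide the order of \<open>G\<close>; so \<open>m\<close> itself is \<open>1\<close> modulo \<open>3\<close>, and \<open>2\<close>
  is not among its divisors.\<close>
lemma modulus_mod_6:
  assumes "type_III G"
  shows "m mod 6 = 1"
proof -
  have "m mod 3 = 1" using assms order_eq by (auto simp: type_III_def)
  moreover have "\<not> 2 dvd m"
  proof
    assume "2 dvd m"
    then have "2 dvd order G" by (simp add: order_eq)
    then show False using assms by (auto simp: type_III_def)
  qed
  ultimately show ?thesis by presburger
qed

end

lemma proj_mod_image_interval:
  assumes "0 \<le> l + a" "l + b < int m"
  shows "proj_mod m ` {l + j | j. a \<le> j \<and> j \<le> b} = {l + a..l + b}"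
proof -
  have "{l + j | j. a \<le> j \<and> j \<le> b} = {l + a..l + b}"
    by (auto intro: exI[of _ "_ - l"])
  moreover have "proj_mod m ` {l + a..l + b} = (\<lambda>x. x) ` {l + a..l + b}"
    using assms by (intro image_cong) (auto simp: proj_mod_def)
  ultimately show ?thesis by simp
qed

lemma (in group) pow_group_exponent:
  assumes "finite (carrier G)" "x \<in> carrier G"
  shows "x [^] group_exponent G = \<one>"
proof -
  let ?P = "\<lambda>n::nat. 0 < n \<and> (\<forall>x\<in>carrier G. x [^] n = \<one>)"
  have "?P (order G)" using assms(1) by (simp add: pow_order_eq_1 order_gt_0_iff_finite)
  then have "?P (LEAST n. ?P n)" by (rule LeastI[of ?P])
  then show ?thesis using assms(2) by (simp add: group_exponent_def)
qed

section \<open>The extremal sets\<close>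

context split_epi
begin

text \<open>The slice at each of the \<open>m\<close> residues is prescribed except at \<open>2k\<close>, \<open>2k + 1\<close>, \<open>4k\<close> and \<open>4k + 1\<close>.
  The two cardinality bounds leave each pair \<open>(2k, 4k)\<close> and \<open>(4k + 1, 2k + 1)\<close> the alternatives of
  \<open>dense_pair_cosets\<close>, and a set is determined by its slices.\<close>
lemma slices_determine_structure:
  assumes k: "1 \<le> k" and m: "int m = 6 * k + 1" and sf: "sum_free G A"
    and in_band: "A \<subseteq> band (2*k) (4*k + 1)"
    and middle: "\<And>i. \<lbrakk>2*k + 2 \<le> i; i \<le> 4*k - 1\<rbrakk> \<Longrightarrow> slice A i = S"
    and large1: "card S \<le> card (slice A (2*k)) + card (slice A (4*k))"
    and large2: "card S \<le> card (slice A (4*k + 1)) + card (slice A (2*k + 1))"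
  shows "\<exists>J b. subgroup J G \<and> J \<subseteq> S \<and> b \<in> S \<and>
     (A = band (2*k + 1) (4*k)
      \<or> (\<exists>B \<in> {A, set_inv A}.
           B = layer (J #> b) (2*k) \<union> band (2*k + 1) (4*k - 1)
             \<union> layer (S - (J #> (b [^] (2::nat)))) (4*k))
      \<or> A = band (2*k + 2) (4*k - 1)
           \<union> layer (J #> b) (2*k)
           \<union> layer (S - (J #> (b [^] (2::nat)))) (4*k)
           \<union> layer (J #> inv b) (4*k + 1)
           \<union> layer (S - (J #> inv (b [^] (2::nat)))) (2*k + 1))"
proof -
  have A: "A \<subseteq> carrier G" using sf by (simp add: sum_free_def)
  have coset_sub: "J #> b \<subseteq> S" if "J \<subseteq> S" "b \<in> S" for J b
    using that subgroup.m_closed[OF S_subgroup] by (auto simp: r_coset_def)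
  have outside: "slice A i = {}" if "0 \<le> i" "i < int m" "i < 2*k \<or> 4*k + 1 < i" for i
  proof -
    have "slice A i \<subseteq> slice (band (2*k) (4*k + 1)) i" using in_band by (auto simp: slice_def)
    then show ?thesis using slice_band[OF that(1,2)] that(3) by auto
  qed
  have slices: "slice A i = (if i = 2*k then slice A (2*k) else if i = 4*k then slice A (4*k)
      else if i = 4*k + 1 then slice A (4*k + 1) else if i = 2*k + 1 then slice A (2*k + 1)
      else if 2*k + 2 \<le> i \<and> i \<le> 4*k - 1 then S else {})"
    if "0 \<le> i" "i < int m" for i
  proof -
    consider "i \<in> {2*k, 4*k, 4*k + 1, 2*k + 1}" | "2*k + 2 \<le> i" "i \<le> 4*k - 1" | "i < 2*k \<or> 4*k + 1 < i"
      by fastforce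
    then show ?thesis using middle outside[OF that] k by cases auto
  qed

  have avoid: "x \<otimes> y \<notin> slice A l"
    if "x \<in> slice A i" "y \<in> slice A j" "(i + j) mod int m = l mod int m" for x y i j l
    using sum_free_slices[OF sf that(1,2)] slice_cong[OF that(3)] by simp
  have wrap: "(i + (6*k + 1)) mod int m = i mod int m" for i
    using mod_add_self2[of i "int m"] m by simp
  have pair: "(slice A i = {} \<and> slice A j = S) \<or>
      (\<exists>J b. subgroup J G \<and> J \<subseteq> S \<and> b \<in> S \<and> slice A i = J #> b
        \<and> slice A j = S - (J #> (b [^] (2::nat))))"
    if "card S \<le> card (slice A i) + card (slice A j)"
      "(i + i) mod int m = j mod int m" for i j
    by (rule dense_pair_cosets[OF S_subgroup S_finite slice_subset slice_subset _ that(1)])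
      (rule avoid[OF _ _ that(2)])
  have pair1: "(slice A (2*k) = {} \<and> slice A (4*k) = S) \<or>
      (\<exists>J b. subgroup J G \<and> J \<subseteq> S \<and> b \<in> S \<and> slice A (2*k) = J #> b
        \<and> slice A (4*k) = S - (J #> (b [^] (2::nat))))"
    by (rule pair[OF large1]) simp
  have pair2: "(slice A (4*k + 1) = {} \<and> slice A (2*k + 1) = S) \<or>
      (\<exists>J b. subgroup J G \<and> J \<subseteq> S \<and> b \<in> S \<and> slice A (4*k + 1) = J #> b
        \<and> slice A (2*k + 1) = S - (J #> (b [^] (2::nat))))"
    using wrap[of "2*k + 1"] by (intro pair[OF large2]) (simp add: algebra_simps)

  consider
      (neither) "slice A (2*k) = {}" "slice A (4*k) = S"
        "slice A (4*k + 1) = {}" "slice A (2*k + 1) = S"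
    | (lower) J b where "subgroup J G" "J \<subseteq> S" "b \<in> S"
        "slice A (2*k) = J #> b" "slice A (4*k) = S - (J #> (b [^] (2::nat)))"
        "slice A (4*k + 1) = {}" "slice A (2*k + 1) = S"
    | (upper) J c where "subgroup J G" "J \<subseteq> S" "c \<in> S"
        "slice A (2*k) = {}" "slice A (4*k) = S"
        "slice A (4*k + 1) = J #> c" "slice A (2*k + 1) = S - (J #> (c [^] (2::nat)))"
    | (both) J K b c where "subgroup J G" "J \<subseteq> S" "b \<in> S" "subgroup K G" "K \<subseteq> S" "c \<in> S"
        "slice A (2*k) = J #> b" "slice A (4*k) = S - (J #> (b [^] (2::nat)))"
        "slice A (4*k + 1) = K #> c" "slice A (2*k + 1) = S - (K #> (c [^] (2::nat)))"
    using pair1 pair2 by metis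
  then show ?thesis
  proof cases
    case neither
    have "A = band (2*k + 1) (4*k)"
    proof (rule set_eq_if_slices_eq[OF A band_carrier])
      fix i assume i: "0 \<le> i" "i < int m"
      show "slice A i = slice (band (2*k + 1) (4*k)) i"
        unfolding slices[OF i] slice_band[OF i] using neither k by auto
    qed
    moreover have "subgroup {\<one>} G" "{\<one>} \<subseteq> S" "\<one> \<in> S"
      using triv_subgroup subgroup.one_closed[OF S_subgroup] by auto
    ultimately show ?thesis
      by (intro exI[of _ "{\<one>}"] exI[of _ "\<one>"] conjI disjI1)
  next
    case lower
    let ?U = "layer (J #> b) (2*k) \<union> band (2*k + 1) (4*k - 1) \<union> layer (S - (J #> (b [^] (2::nat)))) (4*k)"
    have D: "J #> b \<subseteq> S" "S - (J #> (b [^] (2::nat))) \<subseteq> S"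
      using coset_sub lower by auto
    have "A = ?U"
    proof (rule set_eq_if_slices_eq[OF A])
      show "?U \<subseteq> carrier G" using band_carrier layer_carrier[OF D(1)] layer_carrier[OF D(2)] by blast
      fix i assume i: "0 \<le> i" "i < int m"
      have "0 \<le> 2*k" "2*k < int m" "0 \<le> 4*k" "4*k < int m" using k m by auto
      note L = slice_layer[OF D(1) this(1,2) i] slice_layer[OF D(2) this(3,4) i]
      show "slice A i = slice ?U i"
        unfolding slices[OF i] slice_Un slice_band[OF i] L using lower(4-7) k by auto
    qed
    then show ?thesis
      by (intro exI[of _ J] exI[of _ b] conjI disjI2 disjI1 bexI[of _ A] lower) simp_all
  next
    case upper
    (* negation sends the residues 4k + 1 and 2k + 1 to 2k and 4k modulo 6k + 1 *)
    let ?b = "inv c"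
    have c: "c \<in> carrier G" and b: "?b \<in> S"
      using upper(3) S_carrier subgroup.m_inv_closed[OF S_subgroup] by auto
    have inv_S: "inv s \<in> S" if "s \<in> S" for s
      using that subgroup.m_inv_closed[OF S_subgroup] by blast
    let ?U = "layer (J #> ?b) (2*k) \<union> band (2*k + 1) (4*k - 1) \<union> layer (S - (J #> (?b [^] (2::nat)))) (4*k)"
    have D: "J #> ?b \<subseteq> S" "S - (J #> (?b [^] (2::nat))) \<subseteq> S"
      using coset_sub upper(2) b by auto
    have flip: "inv s \<in> J #> c \<longleftrightarrow> s \<in> J #> ?b"
      "inv s \<in> J #> (c [^] (2::nat)) \<longleftrightarrow> s \<in> J #> (?b [^] (2::nat))" if "s \<in> S" for s
      using inv_mem_r_coset_iff[OF upper(1) _ S_carrier[OF that]] c by (simp_all add: nat_pow_inv)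
    have "set_inv A = ?U"
    proof (rule set_eq_if_slices_eq)
      show "set_inv A \<subseteq> carrier G" using A by (auto simp: SET_INV_def)
      show "?U \<subseteq> carrier G" using band_carrier layer_carrier[OF D(1)] layer_carrier[OF D(2)] by blast
      fix i assume i: "0 \<le> i" "i < int m"
      have "0 \<le> 2*k" "2*k < int m" "0 \<le> 4*k" "4*k < int m" using k m by auto
      note L = slice_layer[OF D(1) this(1,2) i] slice_layer[OF D(2) this(3,4) i]
      show "slice (set_inv A) i = slice ?U i"
      proof (cases "i = 0")
        case True
        have "slice A 0 = {}" using outside[of 0] k m by simp
        then show ?thesis
          unfolding slice_Un slice_band[OF i] L slice_set_inv[OF A] using True k by simp
      next
        case False
        (* the representative of - i in the range for which the slices of A are tabulated *)
        let ?j = "6*k + 1 - i"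
        have j: "0 \<le> ?j" "?j < int m" using i m False by auto
        have "slice A (- i) = slice A ?j"
          using wrap[of "- i"] by (intro slice_cong) (simp add: algebra_simps)
        then have "slice (set_inv A) i = {s \<in> S. inv s \<in> slice A ?j}"
          by (simp add: slice_set_inv[OF A])
        then show ?thesis
          unfolding slices[OF j] slice_Un slice_band[OF i] L
          using upper(4-7) k flip inv_S coset_sub[OF upper(2) b] by auto
      qed
    qed
    then show ?thesis
      by (intro exI[of _ J] exI[of _ ?b] conjI disjI2 disjI1 bexI[of _ "set_inv A"] upper b) simp_all
  next
    case both
    have b: "b \<in> carrier G" and c: "c \<in> carrier G" using both S_carrier by auto
    have "x \<otimes> y \<notin> K #> c" if "x \<in> J #> b" "y \<in> S - (K #> (c [^] (2::nat)))" for x y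
      using avoid[of x "2*k" y "2*k + 1" "4*k + 1"] both that by simp
    then have JK: "J \<subseteq> K" "b \<otimes> c \<in> K"
      using coset_avoidance_imp_subset[OF S_subgroup both(1,2,4,3,6)] by blast+
    have "x \<otimes> y \<notin> J #> b" if "x \<in> K #> c" "y \<in> S - (J #> (b [^] (2::nat)))" for x y
      using avoid[of x "4*k + 1" y "4*k" "2*k"] wrap[of "2*k"] both that by (simp add: algebra_simps)
    then have "K \<subseteq> J"
      using coset_avoidance_imp_subset[OF S_subgroup both(4,5,1,6,3)] by blast
    then have K: "K = J" using JK by blast
    have cosets: "K #> c = J #> inv b" "K #> (c [^] (2::nat)) = J #> inv (b [^] (2::nat))"
      using r_coset_cong_inv[OF both(1) b c] JK K by auto
    let ?P = "J #> b" and ?Q = "S - (J #> (b [^] (2::nat)))"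
      and ?R = "J #> inv b" and ?T = "S - (J #> inv (b [^] (2::nat)))"
    let ?U = "band (2*k + 2) (4*k - 1) \<union> layer ?P (2*k) \<union> layer ?Q (4*k) \<union> layer ?R (4*k + 1) \<union> layer ?T (2*k + 1)"
    have D: "?P \<subseteq> S" "?Q \<subseteq> S" "?R \<subseteq> S" "?T \<subseteq> S"
      using coset_sub[OF both(2)] both(3) subgroup.m_inv_closed[OF S_subgroup] by auto
    have "A = ?U"
    proof (rule set_eq_if_slices_eq[OF A])
      show "?U \<subseteq> carrier G"
        using band_carrier layer_carrier[OF D(1)] layer_carrier[OF D(2)] layer_carrier[OF D(3)] layer_carrier[OF D(4)]
        by blast
      fix i assume i: "0 \<le> i" "i < int m"
      have *: "0 \<le> 2*k" "2*k < int m" "0 \<le> 4*k" "4*k < int m"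
        "0 \<le> 4*k + 1" "4*k + 1 < int m" "0 \<le> 2*k + 1" "2*k + 1 < int m" using k m by auto
      note L = slice_layer[OF D(1) *(1,2) i] slice_layer[OF D(2) *(3,4) i]
        slice_layer[OF D(3) *(5,6) i] slice_layer[OF D(4) *(7,8) i]
      show "slice A i = slice ?U i"
        unfolding slices[OF i] slice_Un slice_band[OF i] L using both(7-10) cosets k by auto
    qed
    then show ?thesis
      by (intro exI[of _ J] exI[of _ b] conjI disjI2 both)
  qed
qed

end

theorem theorem1p13:
  fixes G :: "('a, 'b) monoid_scheme"
    and A S C :: "'a set"
    and f g :: "'a \<Rightarrow> int"
    and m :: nat
    and k :: int
    and p :: "int \<Rightarrow> int"
    and \<alpha> :: "int \<Rightarrow> real"
  assumes "comm_group G" and "finite (carrier G)" and "type_III G"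
    and "m = group_exponent G"
    and "k = (int m - 1) div 6"
    and "p = proj_mod m"
    and "sum_free G A"
    and "density G A = max_density G"
    and "f \<in> epi G (integer_mod_group m)"
    and "\<alpha> = fibre_density G A f"
    and "A \<subseteq> f -` p ` {2*k + j | j. 0 \<le> j \<and> j \<le> 2*k + 1} \<inter> carrier G"
    and "\<forall>i \<in> p ` {2*k + j | j. 2 \<le> j \<and> j \<le> 2*k - 1}.
           \<alpha> i \<ge> 1 - real m * (max_density G - density G A)"
    and "\<alpha> (p (2*k)) + \<alpha> (p (4*k)) \<ge> 1 - real m * (max_density G - density G A)"
    and "\<alpha> (p (4*k + 1)) + \<alpha> (p (2*k + 1)) \<ge> 1 - real m * (max_density G - density G A)"
    and "maximal_sum_free G A \<longrightarrow>
           f -` p ` {2*k + j | j. 2 \<le> j \<and> j \<le> 2*k - 1} \<inter> carrier G \<subseteq> A"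
    and "S = kernel G (integer_mod_group m) f"
    and "subgroup C G"
    and "internal_direct_sum G S C"
    and "g = restrict f C"
  shows "\<exists>J b. subgroup J (G\<lparr>carrier := S\<rparr>) \<and> b \<in> S \<and>
     (A = f -` p ` {2*k + j | j. 1 \<le> j \<and> j \<le> 2*k} \<inter> carrier G
      \<or> (\<exists>B \<in> {A, set_inv\<^bsub>G\<^esub> A}.
           B = ((J #>\<^bsub>G\<^esub> b) <#>\<^bsub>G\<^esub> (g -` p ` {2*k} \<inter> C))
             \<union> (f -` p ` {2*k + j | j. 1 \<le> j \<and> j \<le> 2*k - 1} \<inter> carrier G)
             \<union> ((S - (J #>\<^bsub>G\<^esub> (b [^]\<^bsub>G\<^esub> (2::nat)))) <#>\<^bsub>G\<^esub> (g -` p ` {4*k} \<inter> C)))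
      \<or> A = (f -` p ` {2*k + j | j. 2 \<le> j \<and> j \<le> 2*k - 1} \<inter> carrier G)
           \<union> ((J #>\<^bsub>G\<^esub> b) <#>\<^bsub>G\<^esub> (g -` p ` {2*k} \<inter> C))
           \<union> ((S - (J #>\<^bsub>G\<^esub> (b [^]\<^bsub>G\<^esub> (2::nat)))) <#>\<^bsub>G\<^esub> (g -` p ` {4*k} \<inter> C))
           \<union> ((J #>\<^bsub>G\<^esub> (inv\<^bsub>G\<^esub> b)) <#>\<^bsub>G\<^esub> (g -` p ` {4*k + 1} \<inter> C))
           \<union> ((S - (J #>\<^bsub>G\<^esub> (inv\<^bsub>G\<^esub> (b [^]\<^bsub>G\<^esub> (2::nat))))) <#>\<^bsub>G\<^esub> (g -` p ` {2*k + 1} \<inter> C)))"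
proof -
  interpret comm_group G by fact
  interpret split_epi G S C f m
    by (intro split_epi.intro split_epi_axioms.intro) fact+
  have A: "A \<subseteq> carrier G" using assms(7) by (simp add: sum_free_def)
  have m: "int m = 6 * k + 1" using modulus_mod_6[OF assms(3)] assms(5) by presburger
  have alpha: "\<alpha> (p i) = real (card (slice A i)) / real (card S)" for i
    unfolding assms(6,10) proj_mod_def by (rule fibre_density_eq_slice[OF assms(4) A])
  (* For k = 0 the group is trivial and A is empty, against the density hypothesis on
     the residues 2k and 4k; for k \<ge> 1 the four critical residues are distinct. *)
  have k: "1 \<le> k"
  proof (rule ccontr)
    assume "\<not> 1 \<le> k"
    then have "m = 1" using m m_pos by presburger
    then have trivial: "x = \<one>\<^bsub>G\<^esub>" if "x \<in> carrier G" for x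
      using pow_group_exponent[OF assms(2) that] that assms(4) by simp
    have "A = {}"
    proof (rule ccontr)
      assume "A \<noteq> {}"
      then have "\<one>\<^bsub>G\<^esub> \<in> A" using trivial A by blast
      moreover have "\<one>\<^bsub>G\<^esub> \<otimes>\<^bsub>G\<^esub> \<one>\<^bsub>G\<^esub> = \<one>\<^bsub>G\<^esub>" by simp
      ultimately show False using assms(7) unfolding sum_free_def by blast
    qed
    then show False using assms(8,13) alpha by (simp add: slice_def)
  qed

  have band_eq: "f -` p ` {2*k + j | j. a \<le> j \<and> j \<le> b} \<inter> carrier G = band (2*k + a) (2*k + b)"
    if "0 \<le> 2*k + a" "2*k + b < int m" for a b
    using proj_mod_image_interval[OF that] by (simp add: band_def assms(6))
  have band1: "f -` p ` {2*k + j | j. 1 \<le> j \<and> j \<le> 2*k} \<inter> carrier G = band (2*k + 1) (4*k)"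
    using band_eq[of 1 "2*k"] m k by simp
  have band2: "f -` p ` {2*k + j | j. 1 \<le> j \<and> j \<le> 2*k - 1} \<inter> carrier G = band (2*k + 1) (4*k - 1)"
    using band_eq[of 1 "2*k - 1"] m k by simp
  have band3: "f -` p ` {2*k + j | j. 2 \<le> j \<and> j \<le> 2*k - 1} \<inter> carrier G = band (2*k + 2) (4*k - 1)"
    using band_eq[of 2 "2*k - 1"] m k by simp
  have layer_eq: "D <#>\<^bsub>G\<^esub> (g -` p ` {j} \<inter> C) = layer D j" for D j
  proof -
    have "g -` p ` {j} \<inter> C = f -` {j mod int m} \<inter> C"
      by (auto simp: assms(6,19) proj_mod_def)
    then show ?thesis by (simp add: layer_def)
  qed

  (* The loss max_density G - density G A is zero, so the density bounds become bounds by 1. *)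
  have middle: "slice A i = S" if "2*k + 2 \<le> i" "i \<le> 4*k - 1" for i
  proof -
    have "i \<in> {2*k + j | j. 2 \<le> j \<and> j \<le> 2*k - 1}"
      using that by (auto intro: exI[of _ "i - 2*k"])
    then have "1 \<le> \<alpha> (p i)" using assms(8,12) by auto
    then have "card S \<le> card (slice A i)" using card_S_pos by (simp add: alpha field_simps)
    then show ?thesis using card_seteq[OF S_finite slice_subset] by blast
  qed
  have large: "card S \<le> card (slice A i) + card (slice A j)"
    if "1 - real m * (max_density G - density G A) \<le> \<alpha> (p i) + \<alpha> (p j)" for i j
    using that card_S_pos unfolding assms(8) alpha by (simp add: field_simps)
  have in_band: "A \<subseteq> band (2*k) (4*k + 1)"
    using assms(11) band_eq[of 0 "2*k + 1"] m k by simp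
  obtain J b where J: "subgroup J G" "J \<subseteq> S" and shape:
    "b \<in> S \<and>
     (A = band (2*k + 1) (4*k)
      \<or> (\<exists>B \<in> {A, set_inv\<^bsub>G\<^esub> A}.
           B = layer (J #>\<^bsub>G\<^esub> b) (2*k) \<union> band (2*k + 1) (4*k - 1)
             \<union> layer (S - (J #>\<^bsub>G\<^esub> (b [^]\<^bsub>G\<^esub> (2::nat)))) (4*k))
      \<or> A = band (2*k + 2) (4*k - 1)
           \<union> layer (J #>\<^bsub>G\<^esub> b) (2*k)
           \<union> layer (S - (J #>\<^bsub>G\<^esub> (b [^]\<^bsub>G\<^esub> (2::nat)))) (4*k)
           \<union> layer (J #>\<^bsub>G\<^esub> inv\<^bsub>G\<^esub> b) (4*k + 1)
           \<union> layer (S - (J #>\<^bsub>G\<^esub> inv\<^bsub>G\<^esub> (b [^]\<^bsub>G\<^esub> (2::nat)))) (2*k + 1))"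
    using slices_determine_structure[OF k m assms(7) in_band middle
        large[OF assms(13)] large[OF assms(14)]] by blast
  show ?thesis
    unfolding band1 band2 band3 layer_eq
    by (intro exI[of _ J] exI[of _ b] conjI[OF subgroup_incl[OF J(1) S_subgroup J(2)] shape])
qed

end
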